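(* Let $D$ be an $m\times n$ diagram and let $M(D)$ be its associated matrix. Then the invariant factors of $M(D)$ are all powers of $2$.
   Context: An $m\times n$ diagram is an $m\times n$ grid with each square coloured either black or white (no further condition). If $D$ has $N$ white squares, label them $1,\dots,N$ from left to right along rows, rows taken from top to bottom. The associated skew-symmetric matrix $M(D)\in M_N(\mathbb{Z})$ has $M(D)[i,j]=1$ if square $i$ is strictly below square $j$ in the same column or strictly to the right of square $j$ in the same row; $M(D)[i,j]=-1$ if square $i$ is strictly above square $j$ in the same column or strictly to the left of square $j$ in the same row; and $M(D)[i,j]=0$ otherwise. Every skew-symmetric $M\in M_N(\mathbb{Z})$ is congruent over $\mathbb{Z}$ (i.e. $EME^T=S$ with $E\in GL_N(\mathbb{Z})$) to a skew-normal form $S$, the block diagonal matrix with blocks $\begin{pmatrix}0&h_1\\-h_1&0\end{pmatrix},\dots,\begin{pmatrix}0&h_s\\-h_s&0\end{pmatrix}$ followed by a zero block, with $h_i\in\mathbb{Z}\setminus\{0\}$ and $h_i\mid h_{i+1}$. The $h_1,\dots,h_s$ (listed once each, normalised to be positive) are called the invariant factors of $M$. The number $1=2^0$ counts as a power of $2$. *)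

theory Defs
  imports "Jordan_Normal_Form.Matrix"
begin

datatype colour = Black | White

text \<open>
  An \<open>m \<times> n\<close> diagram is an element of \<^term>\<open>carrier_mat m n :: colour mat set\<close>: the square in row
  \<open>i\<close> (counted from the top) and column \<open>j\<close> (counted from the left), both starting at 0,
  has colour \<open>D $$ (i, j)\<close>.
\<close>

text \<open>\<^const>\<open>List.product\<close> enumerates the squares row by row, so this list is the labelling of the
  white squares, with labels starting at 0.\<close>

definition white_squares :: "colour mat \<Rightarrow> (nat \<times> nat) list" where
  "white_squares D =
     filter (\<lambda>s. D $$ s = White) (List.product [0..<dim_row D] [0..<dim_col D])"

definition diagram_matrix :: "colour mat \<Rightarrow> int mat" where
  "diagram_matrix D =
     (let ws = white_squares D; N = length ws in
      mat N N (\<lambda>(i, j).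
        let (r, c) = ws ! i; (r', c') = ws ! j in
        if (c = c' \<and> r > r') \<or> (r = r' \<and> c > c') then 1
        else if (c = c' \<and> r < r') \<or> (r = r' \<and> c < c') then -1
        else 0))"

definition congruent_mat :: "int mat \<Rightarrow> int mat \<Rightarrow> bool" where
  "congruent_mat M S \<longleftrightarrow>
     (\<exists>N. M \<in> carrier_mat N N \<and> S \<in> carrier_mat N N \<and>
        (\<exists>E \<in> carrier_mat N N. invertible_mat E \<and> E * M * transpose_mat E = S))"

definition skew_block :: "int \<Rightarrow> int mat" where
  "skew_block h = mat_of_rows_list 2 [[0, h], [-h, 0]]"

definition skew_normal_form :: "int list \<Rightarrow> nat \<Rightarrow> int mat" where
  "skew_normal_form hs z = diag_block_mat (map skew_block hs @ [0\<^sub>m z z])"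

text \<open>\<open>invariant_factors M ds\<close> says that \<open>ds\<close> is the list of invariant factors of \<open>M\<close>.
  The entries \<open>hs\<close> of the normal form may have either sign; the invariant factors are
  normalised to be positive.\<close>

definition invariant_factors :: "int mat \<Rightarrow> int list \<Rightarrow> bool" where
  "invariant_factors M ds \<longleftrightarrow>
     (\<exists>hs z. congruent_mat M (skew_normal_form hs z) \<and>
        (\<forall>h \<in> set hs. h \<noteq> 0) \<and>
        (\<forall>i. Suc i < length hs \<longrightarrow> hs ! i dvd hs ! Suc i) \<and>
        ds = map abs hs)"

end

theory Submission
  imports Defs "HOL-Computational_Algebra.Primes"
begin

text \<open>
  Let \<open>q\<close> be an odd positive divisor of an invariant factor \<open>h\<close> of \<open>M = M(D)\<close>; the claim is \<open>q = 1\<close>.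
  The idea is that kernel vectors of \<open>M\<close> modulo \<open>q\<close> lift, up to a factor 2, to kernel vectors over
  the integers. The normal form has a column divisible by \<open>q\<close> whose coordinate vanishes on the integral
  kernel, so lifting forces \<open>q\<close> to divide 2 (\<open>dvd_two_if_kernel_lifts\<close>).

  To lift, regard a vector as an integer function \<open>X\<close> on the grid that vanishes on the black squares.
  Attach to each vertical edge of the grid the sum of \<open>X\<close> over the squares of that row to the left of
  the edge minus the sum over those to its right, and attach to horizontal edges the analogous
  difference, above minus below. Write \<open>a\<close>, \<open>a'\<close> for the values on the left and right edges of a
  square and \<open>b\<close>, \<open>b'\<close> for those on its top and bottom edges. Then \<open>a' - a = b' - b = 2 X\<close>, the two end
  edges of each row or column carry opposite values, and at a white square the entry of \<open>M X\<close> is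
  \<open>a' + b = a + b'\<close>. Thus \<open>X\<close> lies in the kernel exactly when \<open>a' = - b\<close> and \<open>b' = - a\<close> at every white
  square: all conditions on the edge values merely say that two values are equal or opposite.

  If these conditions hold modulo \<open>q\<close>, they hold exactly after every edge value is replaced by its
  residue in the interval symmetric about 0, since this choice of residues commutes with negation when
  \<open>q\<close> is odd. The differences \<open>Y = a' - a\<close> of the new edge values then form an integral kernel vector,
  congruent to \<open>2 X\<close> modulo \<open>q\<close> (\<open>lift_kernel_mod_odd\<close>).
\<close>

section \<open>Signed sums along a line\<close>

text \<open>The value attached to the edge just before the square \<open>j\<close> of a line of \<open>n\<close> squares.\<close>

definition cut_sum :: "nat \<Rightarrow> (nat \<Rightarrow> int) \<Rightarrow> nat \<Rightarrow> int" where
  "cut_sum n f j = (\<Sum>i<j. f i) - (\<Sum>i=j..<n. f i)"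

lemma cut_sum_Suc:
  assumes "j < n"
  shows "cut_sum n f (Suc j) = cut_sum n f j + 2 * f j"
  using assms by (simp add: cut_sum_def sum.atLeast_Suc_lessThan)

lemma cut_sum_ends: "cut_sum n f n = - cut_sum n f 0"
  by (simp add: cut_sum_def atLeast0LessThan)

text \<open>
  This recovers a matrix entry from edge values: on the squares before \<open>j\<close> the differences telescope
  to \<open>A j - A 0\<close>, on those after \<open>j\<close> to \<open>A n - A (Suc j)\<close>, and the boundary terms cancel because the
  end values are opposite. It serves both for \<open>cut_sum\<close> and for the edge values of the lifted vector.
\<close>

lemma signed_sum_telescope:
  fixes A :: "nat \<Rightarrow> int"
  assumes "j < n" and "A n = - A 0"
  shows "(\<Sum>i<n. sgn (int j - int i) * (A (Suc i) - A i)) = A j + A (Suc j)"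
proof -
  have "(\<Sum>i<n. sgn (int j - int i) * (A (Suc i) - A i)) = A j + A (Suc j) - A 0 - A n"
    if "Suc j \<le> n" for n
    using that
  proof (induction n rule: dec_induct)
    case base
    have "(\<Sum>i<j. sgn (int j - int i) * (A (Suc i) - A i)) = (\<Sum>i<j. A (Suc i) - A i)"
      by (rule sum.cong) auto
    then show ?case by (simp add: sum_lessThan_telescope)
  next
    case (step n)
    then show ?case by simp
  qed
  with assms show ?thesis by simp
qed

lemma signed_sum_eq_cut_sum:
  assumes "j < n"
  shows "(\<Sum>i<n. sgn (int j - int i) * f i) = cut_sum n f j + f j"
proof -
  have "2 * (\<Sum>i<n. sgn (int j - int i) * f i)
      = (\<Sum>i<n. sgn (int j - int i) * (cut_sum n f (Suc i) - cut_sum n f i))"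
    by (simp add: sum_distrib_left cut_sum_Suc algebra_simps)
  also have "\<dots> = cut_sum n f j + cut_sum n f (Suc j)"
    using assms cut_sum_ends by (rule signed_sum_telescope)
  finally show ?thesis using assms by (simp add: cut_sum_Suc)
qed

section \<open>Symmetric residues\<close>

text \<open>For odd \<open>q\<close>, this is the residue of \<open>v\<close> of least absolute value.\<close>

definition sym_mod :: "int \<Rightarrow> int \<Rightarrow> int" where
  "sym_mod v q = (v + q div 2) mod q - q div 2"

lemma dvd_sym_mod_diff: "q dvd sym_mod v q - v"
proof -
  have "sym_mod v q - v = - (q * ((v + q div 2) div q))"
    unfolding sym_mod_def using mult_div_mod_eq[of q "v + q div 2"] by linarith
  then show ?thesis by simp
qed

text \<open>
  Here oddness is essential: for odd \<open>q\<close> all residues chosen are smaller than \<open>q / 2\<close> in absolute value,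
  so two of them whose sum is divisible by \<open>q\<close> have sum 0. For even \<open>q\<close> the class of \<open>q / 2\<close> is its
  own negative, and no choice of representative is compatible with negation.
\<close>

lemma sym_mod_minus:
  assumes "odd q" "q > 0" and "q dvd v + w"
  shows "sym_mod v q = - sym_mod w q"
proof -
  obtain t where t: "q = 2 * t + 1" using assms(1) by (rule oddE)
  have half: "\<bar>2 * (z - t)\<bar> < q" if "0 \<le> z" "z < q" for z
    using that t by presburger
  have bound: "\<bar>2 * sym_mod u q\<bar> < q" for u
  proof -
    have "sym_mod u q = (u + t) mod q - t" using t by (simp add: sym_mod_def)
    then show ?thesis
      by (simp only:) (intro half pos_mod_sign pos_mod_bound assms(2))
  qed
  have "q dvd (sym_mod v q - v) + (sym_mod w q - w) + (v + w)"
    by (rule dvd_add[OF dvd_add[OF dvd_sym_mod_diff dvd_sym_mod_diff] assms(3)])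
  then have "q dvd sym_mod v q + sym_mod w q" by simp
  moreover have "\<bar>sym_mod v q + sym_mod w q\<bar> < q"
    using bound[of v] bound[of w] by linarith
  ultimately have "sym_mod v q + sym_mod w q = 0"
    using dvd_imp_le_int[of "sym_mod v q + sym_mod w q" q] assms(2) by linarith
  then show ?thesis by simp
qed

section \<open>Lifting kernel vectors of a diagram\<close>

text \<open>
  The entries of the diagram matrix, written as a row contribution plus a column contribution, so that
  its action on vectors splits into signed sums along one row and one column.
\<close>

fun square_sign :: "nat \<times> nat \<Rightarrow> nat \<times> nat \<Rightarrow> int" where
  "square_sign (r, c) (r', c') =
     (if c = c' then sgn (int r - int r') else 0) + (if r = r' then sgn (int c - int c') else 0)"

lemma sum_square_sign:
  assumes "r < m" "c < n"
  shows "(\<Sum>t\<in>{..<m} \<times> {..<n}. square_sign (r, c) t * X t)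
       = (\<Sum>r'<m. sgn (int r - int r') * X (r', c)) + (\<Sum>c'<n. sgn (int c - int c') * X (r, c'))"
proof -
  have "(\<Sum>t\<in>{..<m} \<times> {..<n}. square_sign (r, c) t * X t)
      = (\<Sum>r'<m. \<Sum>c'<n. square_sign (r, c) (r', c') * X (r', c'))"
    unfolding sum.cartesian_product by (intro sum.cong) auto
  also have "\<dots> = (\<Sum>r'<m. \<Sum>c'<n. if c = c' then sgn (int r - int r') * X (r', c') else 0)
      + (\<Sum>r'<m. \<Sum>c'<n. if r = r' then sgn (int c - int c') * X (r', c') else 0)"
    unfolding sum.distrib[symmetric] by (intro sum.cong refl) (auto simp: algebra_simps)
  also have "(\<Sum>r'<m. \<Sum>c'<n. if r = r' then sgn (int c - int c') * X (r', c') else 0)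
      = (\<Sum>c'<n. \<Sum>r'<m. if r = r' then sgn (int c - int c') * X (r', c') else 0)"
    by (rule sum.swap)
  finally show ?thesis using assms by simp
qed

text \<open>
  The heart of the argument. Rounding all edge values to symmetric residues preserves the relations at
  the white squares and at the ends of each line. At a black square opposite edges have the
  same value before and hence after rounding. So the differences of the rounded values along rows and
  along columns define one and the same function \<open>Y\<close>, supported on the white squares, and the
  relations between its edge values say that \<open>Y\<close> lies in the kernel.
\<close>

lemma lift_kernel_mod_odd:
  fixes X :: "nat \<times> nat \<Rightarrow> int"
  assumes q: "odd q" "q > 0"
    and W: "W \<subseteq> {..<m} \<times> {..<n}"
    and supp: "\<And>s. s \<notin> W \<Longrightarrow> X s = 0"
    and ker: "\<And>s. s \<in> W \<Longrightarrow> q dvd (\<Sum>t\<in>W. square_sign s t * X t)"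
  obtains Y where "\<And>s. s \<in> W \<Longrightarrow> (\<Sum>t\<in>W. square_sign s t * Y t) = 0"
    and "\<And>s. s \<in> W \<Longrightarrow> q dvd Y s - 2 * X s"
proof -
  let ?G = "{..<m} \<times> {..<n}"
  define \<alpha> \<beta> where "\<alpha> r = cut_sum n (\<lambda>c. X (r, c))" and "\<beta> c = cut_sum m (\<lambda>r. X (r, c))" for r c
  define A B where "A r j = sym_mod (\<alpha> r j) q" and "B c j = sym_mod (\<beta> c j) q" for r c j
  define Y where "Y = (\<lambda>(r, c). A r (Suc c) - A r c)"
  have grid: "(\<Sum>t\<in>W. square_sign s t * Z t) = (\<Sum>t\<in>?G. square_sign s t * Z t)"
    if "\<And>t. t \<in> ?G - W \<Longrightarrow> Z t = 0" for Z :: "nat \<times> nat \<Rightarrow> int" and s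
    using that W by (intro sum.mono_neutral_left) auto
  have \<alpha>_Suc: "\<alpha> r (Suc c) = \<alpha> r c + 2 * X (r, c)" if "c < n" for r c
    using that by (simp add: \<alpha>_def cut_sum_Suc)
  have \<beta>_Suc: "\<beta> c (Suc r) = \<beta> c r + 2 * X (r, c)" if "r < m" for r c
    using that by (simp add: \<beta>_def cut_sum_Suc)
  have X_off: "X t = 0" if "t \<in> ?G - W" for t
    using that supp by auto
  have turn: "A r (Suc c) = - B c r \<and> B c (Suc r) = - A r c" if s: "(r, c) \<in> W" for r c
  proof -
    have rc: "r < m" "c < n" using s W by auto
    have "(\<Sum>t\<in>W. square_sign (r, c) t * X t) = \<beta> c r + X (r, c) + (\<alpha> r c + X (r, c))"
      by (subst grid, erule X_off) (simp add: sum_square_sign rc signed_sum_eq_cut_sum \<alpha>_def \<beta>_def)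
    then have "q dvd \<alpha> r (Suc c) + \<beta> c r" "q dvd \<beta> c (Suc r) + \<alpha> r c"
      using ker[OF s] rc by (auto simp: \<alpha>_Suc \<beta>_Suc algebra_simps)
    then show ?thesis unfolding A_def B_def using q by (auto intro: sym_mod_minus)
  qed
  have Y_off: "Y t = 0" if "t \<in> ?G - W" for t
    using that supp by (auto simp: Y_def A_def \<alpha>_Suc)
  \<comment> \<open>At a white square both differences equal \<open>- A r c - B c r\<close>; at a black square both are 0.\<close>
  have Y_col: "Y (r, c) = B c (Suc r) - B c r" if "r < m" "c < n" for r c
  proof (cases "(r, c) \<in> W")
    case True
    then show ?thesis using turn by (simp add: Y_def)
  next
    case False
    then show ?thesis using that supp by (simp add: Y_def A_def B_def \<alpha>_Suc \<beta>_Suc)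
  qed
  have A_ends: "A r n = - A r 0" and B_ends: "B c m = - B c 0" for r c
    unfolding A_def B_def \<alpha>_def \<beta>_def
    by (intro sym_mod_minus q; simp add: cut_sum_ends)+
  show ?thesis
  proof
    fix s assume s: "s \<in> W"
    obtain r c where rc: "s = (r, c)" by (cases s)
    have lt: "r < m" "c < n" using s W rc by auto
    have "(\<Sum>t\<in>W. square_sign s t * Y t)
        = (\<Sum>r'<m. sgn (int r - int r') * Y (r', c)) + (\<Sum>c'<n. sgn (int c - int c') * Y (r, c'))"
      unfolding rc by (subst grid, erule Y_off) (rule sum_square_sign[OF lt])
    also have "(\<Sum>r'<m. sgn (int r - int r') * Y (r', c)) = B c r + B c (Suc r)"
      using signed_sum_telescope[of r m "B c", OF lt(1) B_ends] lt by (simp add: Y_col)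
    also have "(\<Sum>c'<n. sgn (int c - int c') * Y (r, c')) = A r c + A r (Suc c)"
      using signed_sum_telescope[of c n "A r", OF lt(2) A_ends] by (simp add: Y_def)
    finally show "(\<Sum>t\<in>W. square_sign s t * Y t) = 0"
      using turn s rc by simp
    have "q dvd (A r (Suc c) - \<alpha> r (Suc c)) - (A r c - \<alpha> r c)"
      unfolding A_def by (intro dvd_diff dvd_sym_mod_diff)
    then show "q dvd Y s - 2 * X s"
      using lt by (simp add: rc Y_def \<alpha>_Suc algebra_simps)
  qed
qed

lemma distinct_white_squares: "distinct (white_squares D)"
  by (simp add: white_squares_def distinct_product)

lemma set_white_squares: "set (white_squares D) \<subseteq> {..<dim_row D} \<times> {..<dim_col D}"
  by (auto simp: white_squares_def)

lemma diagram_matrix_carrier: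
  "diagram_matrix D \<in> carrier_mat (length (white_squares D)) (length (white_squares D))"
  by (simp add: diagram_matrix_def Let_def)

lemma diagram_matrix_index:
  assumes "i < length (white_squares D)" "j < length (white_squares D)"
  shows "diagram_matrix D $$ (i, j) = square_sign (white_squares D ! i) (white_squares D ! j)"
  using assms
  by (cases "white_squares D ! i"; cases "white_squares D ! j")
    (auto simp: diagram_matrix_def Let_def)

lemma diagram_matrix_mult_vec_index:
  fixes D defines "ws \<equiv> white_squares D"
  assumes "i < length ws"
  shows "(diagram_matrix D *\<^sub>v vec (length ws) (\<lambda>j. f (ws ! j))) $ i
       = (\<Sum>t\<in>set ws. square_sign (ws ! i) t * f t)"
proof -
  have bij: "bij_betw ((!) ws) {..<length ws} (set ws)"
    unfolding ws_def by (rule bij_betw_nth[OF distinct_white_squares refl refl])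
  have "(diagram_matrix D *\<^sub>v vec (length ws) (\<lambda>j. f (ws ! j))) $ i
      = (\<Sum>j<length ws. square_sign (ws ! i) (ws ! j) * f (ws ! j))"
    using assms diagram_matrix_carrier[of D]
    by (auto simp: scalar_prod_def diagram_matrix_index atLeast0LessThan intro!: sum.cong)
  also have "\<dots> = (\<Sum>t\<in>set ws. square_sign (ws ! i) t * f t)"
    using bij by (rule sum.reindex_bij_betw)
  finally show ?thesis .
qed

lemma diagram_matrix_lift_kernel:
  assumes q: "odd q" "q > 0"
    and x: "x \<in> carrier_vec (length (white_squares D))"
    and ker: "\<And>i. i < length (white_squares D) \<Longrightarrow> q dvd (diagram_matrix D *\<^sub>v x) $ i"
  obtains y where "y \<in> carrier_vec (length (white_squares D))"
    and "diagram_matrix D *\<^sub>v y = 0\<^sub>v (length (white_squares D))"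
    and "\<And>i. i < length (white_squares D) \<Longrightarrow> q dvd y $ i - 2 * x $ i"
proof -
  let ?ws = "white_squares D" and ?N = "length (white_squares D)"
  define X where "X s = (if s \<in> set ?ws then x $ the_inv_into {..<?N} ((!) ?ws) s else 0)" for s
  have inj: "inj_on ((!) ?ws) {..<?N}"
    using distinct_white_squares by (simp add: inj_on_nth)
  have X_nth: "X (?ws ! j) = x $ j" if "j < ?N" for j
    using that the_inv_into_f_f[OF inj] by (simp add: X_def)
  have x_eq: "x = vec ?N (\<lambda>j. X (?ws ! j))"
    using x by (intro eq_vecI) (auto simp: X_nth)
  have X_ker: "q dvd (\<Sum>t\<in>set ?ws. square_sign s t * X t)" if s: "s \<in> set ?ws" for s
  proof -
    obtain i where i: "i < ?N" "s = ?ws ! i" using s by (metis in_set_conv_nth)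
    show ?thesis
      using ker[OF i(1)] diagram_matrix_mult_vec_index[OF i(1), of X] i(2)
      unfolding x_eq[symmetric] by metis
  qed
  obtain Y where Y: "\<And>s. s \<in> set ?ws \<Longrightarrow> (\<Sum>t\<in>set ?ws. square_sign s t * Y t) = 0"
    and YX: "\<And>s. s \<in> set ?ws \<Longrightarrow> q dvd Y s - 2 * X s"
  proof (rule lift_kernel_mod_odd[OF q set_white_squares, of D X])
    show "X s = 0" if "s \<notin> set ?ws" for s using that by (simp add: X_def)
  qed (use X_ker in blast)+
  show ?thesis
  proof
    show "vec ?N (\<lambda>j. Y (?ws ! j)) \<in> carrier_vec ?N" by simp
    show "diagram_matrix D *\<^sub>v vec ?N (\<lambda>j. Y (?ws ! j)) = 0\<^sub>v ?N"
      using diagram_matrix_carrier[of D] Y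
      by (intro eq_vecI) (simp_all add: diagram_matrix_mult_vec_index del: index_mult_mat_vec)
    show "q dvd vec ?N (\<lambda>j. Y (?ws ! j)) $ i - 2 * x $ i" if "i < ?N" for i
      using that YX[of "?ws ! i"] by (simp add: X_nth)
  qed
qed

section \<open>Lifting excludes odd divisors of the invariant factors\<close>

lemma skew_block_dim: "dim_row (skew_block h) = 2" "dim_col (skew_block h) = 2"
  by (simp_all add: skew_block_def mat_of_rows_list_def)

lemma skew_block_index:
  assumes "i < 2" "j < 2"
  shows "skew_block h $$ (i, j) = (if i = j then 0 else if i = 0 then h else - h)"
  using assms by (auto simp: skew_block_def mat_of_rows_list_def less_2_cases_iff)

lemma skew_normal_form_Cons:
  "skew_normal_form (h # hs) z =
     (let S = skew_normal_form hs z in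
      four_block_mat (skew_block h) (0\<^sub>m 2 (dim_col S)) (0\<^sub>m (dim_row S) 2) S)"
  by (simp add: skew_normal_form_def Let_def skew_block_dim)

text \<open>
  The column \<open>k\<close> is the first and the row \<open>l\<close> the second one of the block of \<open>h\<close>: the column is
  divisible by every divisor of \<open>h\<close>, while the row forces the \<open>k\<close>-th coordinate of a kernel vector to
  be 0.
\<close>

lemma skew_normal_form_entries:
  assumes "h \<in> set hs"
  shows "\<exists>k<dim_col (skew_normal_form hs z). \<exists>l<dim_row (skew_normal_form hs z).
     (\<forall>i<dim_row (skew_normal_form hs z).
        skew_normal_form hs z $$ (i, k) = (if i = l then - h else 0)) \<and>
     (\<forall>j<dim_col (skew_normal_form hs z).
        skew_normal_form hs z $$ (l, j) = (if j = k then - h else 0))"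
  using assms
proof (induction hs)
  case Nil
  then show ?case by simp
next
  case (Cons g hs)
  let ?S = "skew_normal_form hs z"
  show ?case
  proof (cases "h = g")
    case True
    show ?thesis
      by (rule exI[of _ 0], intro conjI exI[of _ 1])
        (use True in \<open>auto simp: skew_normal_form_Cons Let_def skew_block_dim
          skew_block_index\<close>)
  next
    case False
    then obtain k l where kl: "k < dim_col ?S" "l < dim_row ?S"
      "\<forall>i<dim_row ?S. ?S $$ (i, k) = (if i = l then - h else 0)"
      "\<forall>j<dim_col ?S. ?S $$ (l, j) = (if j = k then - h else 0)"
      using Cons by auto
    show ?thesis
      by (rule exI[of _ "k + 2"], intro conjI exI[of _ "l + 2"])
        (use kl in \<open>auto simp: skew_normal_form_Cons Let_def skew_block_dim\<close>)
  qed
qed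

lemma dvd_mult_mat_vec_index:
  fixes A :: "int mat"
  assumes "i < dim_row A" "v \<in> carrier_vec (dim_col A)" "\<And>j. j < dim_col A \<Longrightarrow> q dvd v $ j"
  shows "q dvd (A *\<^sub>v v) $ i"
  using assms by (auto simp: scalar_prod_def intro!: dvd_sum)

text \<open>
  The unit vector \<open>e\<close> at the position \<open>k\<close> lies in the kernel of the normal form modulo \<open>q\<close>. Transport
  it to the kernel of \<open>M\<close> modulo \<open>q\<close>, lift it there, and transport the lift back: the result is
  congruent to \<open>2 e\<close> modulo \<open>q\<close> and lies in the integral kernel, so its entry at \<open>k\<close> is 0.
\<close>

lemma dvd_two_if_kernel_lifts:
  fixes M :: "int mat"
  assumes M: "M \<in> carrier_mat N N"
    and lift: "\<And>x. x \<in> carrier_vec N \<Longrightarrow> (\<And>i. i < N \<Longrightarrow> q dvd (M *\<^sub>v x) $ i) \<Longrightarrow>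
      \<exists>y\<in>carrier_vec N. M *\<^sub>v y = 0\<^sub>v N \<and> (\<forall>i<N. q dvd y $ i - 2 * x $ i)"
    and cong: "congruent_mat M (skew_normal_form hs z)"
    and h: "h \<in> set hs" "h \<noteq> 0" "q dvd h"
  shows "q dvd 2"
proof -
  let ?S = "skew_normal_form hs z"
  obtain E where S: "?S \<in> carrier_mat N N" and E: "E \<in> carrier_mat N N"
    and "invertible_mat E" and EME: "E * M * E\<^sup>T = ?S"
    using cong M unfolding congruent_mat_def by auto
  then obtain F where F: "inverts_mat E F" "inverts_mat F E"
    unfolding invertible_mat_def by auto
  have FN: "F \<in> carrier_mat N N"
    using F E unfolding inverts_mat_def
    by (metis carrier_matD carrier_matI index_mult_mat(2,3) index_one_mat(2,3))
  have FE: "F * E = 1\<^sub>m N" and EF: "E * F = 1\<^sub>m N"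
    using F E FN by (simp_all add: inverts_mat_def)
  have FtEt: "F\<^sup>T * E\<^sup>T = 1\<^sub>m N" and EtFt: "E\<^sup>T * F\<^sup>T = 1\<^sub>m N"
    by (simp_all add: transpose_mult[OF E FN, symmetric] transpose_mult[OF FN E, symmetric] EF FE)
  obtain k l where k: "k < N" and l: "l < N"
    and col_k: "\<And>i. i < N \<Longrightarrow> ?S $$ (i, k) = (if i = l then - h else 0)"
    and row_l: "\<And>j. j < N \<Longrightarrow> ?S $$ (l, j) = (if j = k then - h else 0)"
    using skew_normal_form_entries[OF h(1), of z] S by auto
  define x where "x = E\<^sup>T *\<^sub>v unit_vec N k"
  have x: "x \<in> carrier_vec N" using E by (simp add: x_def)
  have Sk: "E *\<^sub>v (M *\<^sub>v x) = ?S *\<^sub>v unit_vec N k"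
    using E M by (simp add: x_def EME[symmetric] assoc_mult_mat_vec[of _ N N _ N])
  have Mx: "M *\<^sub>v x = F *\<^sub>v (?S *\<^sub>v unit_vec N k)"
    using E FN M x FE by (simp add: Sk[symmetric] assoc_mult_mat_vec[of F N N E N, symmetric])
  have "q dvd (M *\<^sub>v x) $ i" if "i < N" for i
    unfolding Mx
    by (rule dvd_mult_mat_vec_index) (use FN S that k h(3) in \<open>auto simp: col_k\<close>)
  then obtain y where y: "y \<in> carrier_vec N" and My: "M *\<^sub>v y = 0\<^sub>v N"
    and yx: "\<And>i. i < N \<Longrightarrow> q dvd y $ i - 2 * x $ i"
    using lift[OF x] by blast
  define v where "v = F\<^sup>T *\<^sub>v y"
  have v: "v \<in> carrier_vec N" using FN y by (simp add: v_def)
  have "E\<^sup>T *\<^sub>v v = y"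
    using E FN y EtFt by (simp add: v_def assoc_mult_mat_vec[of "E\<^sup>T" N N "F\<^sup>T" N, symmetric])
  then have "?S *\<^sub>v v = E *\<^sub>v (M *\<^sub>v y)"
    using E M v by (simp add: EME[symmetric] assoc_mult_mat_vec[of _ N N _ N])
  then have "(?S *\<^sub>v v) $ l = 0"
    using E l by (simp add: My)
  moreover have "(?S *\<^sub>v v) $ l = (\<Sum>j<N. (if j = k then - h else 0) * v $ j)"
    using S v l by (simp add: scalar_prod_def row_l atLeast0LessThan)
  moreover have "\<dots> = (\<Sum>j<N. if j = k then - h * v $ j else 0)"
    by (intro sum.cong) auto
  ultimately have vk: "v $ k = 0"
    using h(2) k by simp
  have "F\<^sup>T *\<^sub>v x = unit_vec N k"
    using E FN FtEt by (simp add: x_def assoc_mult_mat_vec[of "F\<^sup>T" N N "E\<^sup>T" N, symmetric])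
  moreover have "F\<^sup>T *\<^sub>v (2 \<cdot>\<^sub>v x) = 2 \<cdot>\<^sub>v (F\<^sup>T *\<^sub>v x)"
    using FN x by (intro eq_vecI) auto
  ultimately have "F\<^sup>T *\<^sub>v (y - 2 \<cdot>\<^sub>v x) = v - 2 \<cdot>\<^sub>v unit_vec N k"
    using FN x y by (simp add: v_def mult_minus_distrib_mat_vec[of _ N N])
  moreover have "q dvd (F\<^sup>T *\<^sub>v (y - 2 \<cdot>\<^sub>v x)) $ k"
    using FN x y k yx by (intro dvd_mult_mat_vec_index) auto
  ultimately show ?thesis using v k vk by simp
qed

theorem theorem3p3:
  fixes D :: "colour mat" and m n :: nat and ds :: "int list"
  assumes "D \<in> carrier_mat m n"
    and "invariant_factors (diagram_matrix D) ds"
  shows "\<forall>d \<in> set ds. \<exists>k::nat. d = 2 ^ k"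
proof
  fix d assume "d \<in> set ds"
  then obtain hs z h where cong: "congruent_mat (diagram_matrix D) (skew_normal_form hs z)"
    and h: "h \<in> set hs" "h \<noteq> 0" and d: "d = \<bar>h\<bar>"
    using assms(2) unfolding invariant_factors_def by auto
  have "\<bar>h\<bar> \<noteq> 0" "\<not> is_unit (2 :: int)" using h by auto
  then obtain q where q: "\<bar>h\<bar> = 2 ^ multiplicity 2 \<bar>h\<bar> * q" "odd q"
    by (rule multiplicity_decompose')
  then have "0 < 2 ^ multiplicity 2 \<bar>h\<bar> * q"
    using h(2) by (metis zero_less_abs_iff)
  then have "q > 0"
    by (simp add: zero_less_mult_iff)
  have "q dvd h"
    using q(1) by (metis dvd_abs_iff dvd_triv_right)
  then have "q dvd 2"
    using dvd_two_if_kernel_lifts[OF diagram_matrix_carrier _ cong h]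
      diagram_matrix_lift_kernel[OF q(2) \<open>q > 0\<close>] by metis
  moreover have "coprime q 2" using q(2) by simp
  ultimately have "q = 1" using \<open>q > 0\<close>
    by (metis coprime_absorb_left zdvd1_eq abs_of_pos)
  then show "\<exists>k::nat. d = 2 ^ k" using q(1) d by auto
qed

end
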